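(* Let $0<p\le1$, $q>1$, $\beta>0$, $\epsilon\ge0$. Let $\bm{A}\in\mathbb{R}^{m\times n}$, $\bm{b}\in\mathbb{R}^m$, and let $\bm{x}\in\mathbb{R}^n$, $\bm{x}\ne\bm{0}$, satisfy $\|\bm{b}-\bm{A}\bm{x}\|_2\le\epsilon$ and $\frac{\|\bm{x}\|_p}{\|\bm{x}\|_q}\le\beta$. Let $\hat{\bm{x}}$ be a solution (global minimizer) of $$\inf_{\bm{z}\in\mathbb{R}^n\setminus\{\bm{0}\}}\left\{\frac{\|\bm{z}\|_p^p}{\|\bm{z}\|_q^p}\;\middle|\;\|\bm{A}\bm{z}-\bm{b}\|_2\le\epsilon\right\}.$$ Let $1\le k<n$ and $1\le t\le n-k$ be integers. Define $a_p:=3^{\frac{1-p}{p}}$, $\vartheta_q:=\max\{\frac1q-\frac12,0\}$, $$\rho:=a_p\sqrt{\tfrac kt}+\tfrac14\sqrt{\tfrac tk},\quad\alpha:=a_p\,\beta\,k^{\frac{p-1}{p}+\vartheta_q}t^{-\frac12},\quad\overline\eta:=a_p\,\beta\,k^{\frac{p-1}{p}}t^{\vartheta_q-\frac12},\quad C:=a_p\,2^{\frac1p}k^{\frac{p-1}{p}}t^{-\frac12},$$ $$\overline\tau:=\frac{\rho+\alpha}{1-\overline\eta},\qquad\overline\psi:=\delta_k+\delta_{k+t}\,\overline\tau.$$ If $\bm{A}$ satisfies the $(k+t)$-RIP, and $\overline\eta<1$ and $\overline\psi<1$, then $$\|\hat{\bm{x}}-\bm{x}\|_2\le\overline C_1\|\bm{x}_{-\max(k)}\|_p+\overline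 C_2\epsilon,$$ where $$\overline C_1:=\frac{C}{1-\overline\eta}\left(1+\frac{(1+\overline\tau)\delta_{k+t}}{1-\overline\psi}\right),\qquad\overline C_2:=\frac{2(1+\overline\tau)\sqrt{1+\delta_k}}{1-\overline\psi}.$$
   Context: For $0<r<\infty$, $\|\bm{u}\|_r:=(\sum_i|u_i|^r)^{1/r}$ (a quasi-norm if $r<1$). $\bm{x}_{\max(k)}$ is obtained from $\bm{x}$ by keeping its $k$ largest entries in magnitude and setting the others to zero; $\bm{x}_{-\max(k)}:=\bm{x}-\bm{x}_{\max(k)}$. Restricted isometry constant (RIC) $\delta_s$ of $\bm{A}$: the smallest number such that $(1-\delta_s)\|\bm{u}\|_2^2\le\|\bm{A}\bm{u}\|_2^2\le(1+\delta_s)\|\bm{u}\|_2^2$ for all $\bm{u}$ with at most $s$ nonzero entries; $\bm{A}$ satisfies the $s$-RIP if $\delta_s\in[0,1)$. *)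

theory Defs
  imports "HOL-Analysis.Analysis"
begin

definition lr_norm :: "real \<Rightarrow> real ^ 'n \<Rightarrow> real" where
  "lr_norm r u = (\<Sum>i\<in>UNIV. \<bar>u $ i\<bar> powr r) powr (1 / r)"

text \<open>
  The vector \<open>x\<^sub>m\<^sub>a\<^sub>x\<^sub>(\<^sub>k\<^sub>)\<close> is unique only up to the choice among entries of equal magnitude,
  so it is described by a relation that admits every choice of tie-breaking.
\<close>

definition is_max_part :: "nat \<Rightarrow> real ^ 'n \<Rightarrow> real ^ 'n \<Rightarrow> bool" where
  "is_max_part k x y \<longleftrightarrow>
     (\<exists>S. card S = k \<and> (\<forall>i\<in>S. \<forall>j. j \<notin> S \<longrightarrow> \<bar>x $ j\<bar> \<le> \<bar>x $ i\<bar>) \<and>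
          y = (\<chi> i. if i \<in> S then x $ i else 0))"

lemma is_max_part_exists:
  fixes x :: "real ^ 'n"
  assumes "k \<le> CARD('n)"
  shows "\<exists>y. is_max_part k x y"
proof -
  have "\<exists>S. card S = k \<and> (\<forall>i\<in>S. \<forall>j. j \<notin> S \<longrightarrow> \<bar>x $ j\<bar> \<le> \<bar>x $ i\<bar>)"
    using assms
  proof (induction k)
    case 0
    show ?case by (rule exI[of _ "{}"]) simp
  next
    case (Suc k)
    then obtain S where S: "card S = k" "\<forall>i\<in>S. \<forall>j. j \<notin> S \<longrightarrow> \<bar>x $ j\<bar> \<le> \<bar>x $ i\<bar>"
      by auto
    have "S \<noteq> UNIV" using S(1) Suc.prems by auto
    then have ne: "- S \<noteq> {}" by auto
    have "Max ((\<lambda>i. \<bar>x $ i\<bar>) ` (- S)) \<in> (\<lambda>i. \<bar>x $ i\<bar>) ` (- S)"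
      using ne by (intro Max_in) auto
    then obtain m where m: "m \<notin> S" "\<bar>x $ m\<bar> = Max ((\<lambda>i. \<bar>x $ i\<bar>) ` (- S))"
      by auto
    have "\<bar>x $ j\<bar> \<le> \<bar>x $ m\<bar>" if "j \<notin> S" for j
      unfolding m(2) using that by (intro Max_ge) auto
    then show ?case
      using S m(1) by (intro exI[of _ "insert m S"]) auto
  qed
  then show ?thesis by (auto simp: is_max_part_def)
qed

definition rip_bound :: "real ^ 'n ^ 'm \<Rightarrow> nat \<Rightarrow> real \<Rightarrow> bool" where
  "rip_bound A s d \<longleftrightarrow>
     (\<forall>u. card {i. u $ i \<noteq> 0} \<le> s \<longrightarrow>
        (1 - d) * (norm u)\<^sup>2 \<le> (norm (A *v u))\<^sup>2 \<and>
        (norm (A *v u))\<^sup>2 \<le> (1 + d) * (norm u)\<^sup>2)"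

definition ric :: "real ^ 'n ^ 'm \<Rightarrow> nat \<Rightarrow> real" where
  "ric A s = (LEAST d. rip_bound A s d)"

definition rip :: "real ^ 'n ^ 'm \<Rightarrow> nat \<Rightarrow> bool" where
  "rip A s \<longleftrightarrow> 0 \<le> ric A s \<and> ric A s < 1"

text \<open>
  For \<open>s = 0\<close> every \<open>d\<close> is admissible and no least one exists; for \<open>s \<ge> 1\<close> the least
  element is attained:
\<close>

lemma ric_least:
  fixes A :: "real ^ 'n ^ 'm"
  assumes "1 \<le> s"
  shows "rip_bound A s (ric A s)" and "rip_bound A s d \<Longrightarrow> ric A s \<le> d"
proof -
  let ?D = "{d. rip_bound A s d}"
  have nonneg: "0 \<le> d" if "rip_bound A s d" for d
  proof -
    let ?u = "axis undefined 1 :: real ^ 'n"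
    have "{i. ?u $ i \<noteq> 0} = {undefined}" by (auto simp: axis_def)
    then have "1 - d \<le> 1 + d"
      using that[unfolded rip_bound_def, rule_format, of ?u] assms
      by (simp add: norm_axis_1)
    then show ?thesis by simp
  qed
  then have bdd: "bdd_below ?D" by (auto simp: bdd_below_def)
  have "?D = (\<Inter>u\<in>{u. card {i. u $ i \<noteq> 0} \<le> s}.
      {d. (1 - d) * (norm u)\<^sup>2 \<le> (norm (A *v u))\<^sup>2} \<inter>
      {d. (norm (A *v u))\<^sup>2 \<le> (1 + d) * (norm u)\<^sup>2})"
    by (auto simp: rip_bound_def)
  moreover have "closed \<dots>"
    by (intro closed_INT ballI closed_Int closed_Collect_le continuous_intros)
  ultimately have cl: "closed ?D" by simp
  obtain K where K: "\<And>u. norm (A *v u) \<le> norm u * K" and "K > 0"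
    using bounded_linear.pos_bounded[OF matrix_vector_mul_bounded_linear[of A]] by blast
  have "rip_bound A s (1 + K\<^sup>2)"
    unfolding rip_bound_def
  proof (intro allI impI conjI)
    fix u :: "real ^ 'n"
    have "(1 - (1 + K\<^sup>2)) * (norm u)\<^sup>2 \<le> 0"
      by simp
    also have "0 \<le> (norm (A *v u))\<^sup>2" by simp
    finally show "(1 - (1 + K\<^sup>2)) * (norm u)\<^sup>2 \<le> (norm (A *v u))\<^sup>2" .
    have "(norm (A *v u))\<^sup>2 \<le> (norm u * K)\<^sup>2"
      by (intro power_mono K) simp
    also have "\<dots> \<le> (1 + (1 + K\<^sup>2)) * (norm u)\<^sup>2"
      by (simp add: power_mult_distrib algebra_simps)
    finally show "(norm (A *v u))\<^sup>2 \<le> (1 + (1 + K\<^sup>2)) * (norm u)\<^sup>2" .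
  qed
  then have ne: "?D \<noteq> {}" by auto
  have in_D: "rip_bound A s (Inf ?D)"
    using closed_contains_Inf[OF ne bdd cl] by simp
  have low: "Inf ?D \<le> d" if "rip_bound A s d" for d
    using cInf_lower[OF _ bdd] that by simp
  have eq: "ric A s = Inf ?D"
    unfolding ric_def by (rule Least_equality) (use in_D low in auto)
  show "rip_bound A s (ric A s)" using in_D eq by simp
  show "rip_bound A s d \<Longrightarrow> ric A s \<le> d" using low eq by simp
qed

end

theory Submission
  imports Defs
begin

text \<open>
  Put \<open>h = xhat - x\<close>, let \<open>T\<close> carry the \<open>k\<close> largest entries of \<open>h\<close>, and write \<open>\<sigma>\<close> for the
  \<open>p\<close>-quasi-norm of the tail of \<open>x\<close>. Since \<open>xhat\<close> has the smaller ratio, Minkowski in \<open>l\<^sub>q\<close> and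
  subadditivity of \<open>s powr p\<close> yield a cone condition that bounds the \<open>p\<close>-quasi-norm of \<open>h\<close> off
  \<open>T\<close> by \<open>a\<close> times the sum of that on \<open>T\<close>, of \<open>2 powr (1 / p) * \<sigma>\<close> and of \<open>\<beta> * lr_norm q h\<close>.
  Cutting the complement of \<open>T\<close> into blocks of size at most \<open>t\<close> in decreasing order, the sum \<open>\<Sigma>\<close>
  of the Euclidean norms of the blocks is at most the \<open>l\<^sub>1\<close> norm off \<open>T\<close> over \<open>sqrt t\<close> plus
  \<open>sqrt t / 4\<close> times the largest entry there. The \<open>l\<^sub>q\<close> norm of \<open>h\<close> is in turn controlled by
  the Euclidean norm \<open>H\<close> on \<open>T\<close> and by \<open>\<Sigma>\<close>; absorbing the latter, which needs \<open>\<eta> < 1\<close>, gives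
  \<open>\<Sigma> \<le> \<tau> * H + C / (1 - \<eta>) * \<sigma>\<close>. Finally the restricted isometry property applied to
  \<open>A *v h\<close> paired with the image of \<open>h\<close> on \<open>T\<close> bounds \<open>H\<close>, which needs \<open>\<psi> < 1\<close>.
\<close>

section \<open>Power inequalities for finite sums\<close>

text \<open>After division by \<open>x + y\<close> both summands lie in [0, 1], where a number is at
  most its p-th power because \<open>p \<le> 1\<close>.\<close>

lemma powr_add_le:
  fixes x y p :: real
  assumes "0 < p" "p \<le> 1" "0 \<le> x" "0 \<le> y"
  shows "(x + y) powr p \<le> x powr p + y powr p"
proof (cases "x + y = 0")
  case False
  then have pos: "x + y > 0" using assms by simp
  have *: "u / (x + y) \<le> (u / (x + y)) powr p" if "0 \<le> u" "u \<le> x + y" for u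
    using powr_mono'[of p 1 "u / (x + y)"] that assms pos by simp
  have "1 = x / (x + y) + y / (x + y)"
    using pos by (simp add: add_divide_distrib[symmetric])
  also have "\<dots> \<le> (x / (x + y)) powr p + (y / (x + y)) powr p"
    using * assms by (intro add_mono) auto
  also have "\<dots> = (x powr p + y powr p) / (x + y) powr p"
    by (simp add: powr_divide add_divide_distrib)
  finally show ?thesis using pos by (simp add: field_simps)
qed (use assms in auto)

lemma powr_sum_le:
  fixes f :: "'a \<Rightarrow> real"
  assumes "finite S" "0 < p" "p \<le> 1" "\<And>i. i \<in> S \<Longrightarrow> 0 \<le> f i"
  shows "(\<Sum>i\<in>S. f i) powr p \<le> (\<Sum>i\<in>S. f i powr p)"
  using assms(1,4)
proof (induction S rule: finite_induct)
  case (insert x F)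
  have "(f x + sum f F) powr p \<le> f x powr p + sum f F powr p"
    using insert.prems assms(2,3) by (intro powr_add_le sum_nonneg) auto
  then show ?case using insert by force
qed simp

text \<open>Convexity on the open half-line extends to the endpoint 0: a chord starting there only
  asks for \<open>t powr r \<le> t\<close>.\<close>

lemma convex_on_powr_nonneg:
  fixes r :: real
  assumes "1 \<le> r"
  shows "convex_on {0..} (\<lambda>x. x powr r)"
proof (rule convex_on_linorderI)
  fix t x y :: real
  assume t: "0 < t" "t < 1" and xy: "x \<in> {0..}" "y \<in> {0..}" "x < y"
  show "((1 - t) *\<^sub>R x + t *\<^sub>R y) powr r \<le> (1 - t) * x powr r + t * y powr r"
  proof (cases "x = 0")
    case True
    have "t powr r \<le> t" using powr_mono'[of 1 r t] assms t by simp
    then show ?thesis using True xy by (simp add: powr_mult mult_right_mono)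
  next
    case False
    then show ?thesis
      using convex_onD[OF powr_convex[OF assms], of t x y] t xy by simp
  qed
qed simp

text \<open>Jensen's inequality with equal weights \<open>1 / card S\<close>.\<close>

lemma powr_sum_le_card:
  fixes f :: "'a \<Rightarrow> real"
  assumes "finite S" "1 \<le> r" "\<And>i. i \<in> S \<Longrightarrow> 0 \<le> f i"
  shows "(\<Sum>i\<in>S. f i) powr r \<le> real (card S) powr (r - 1) * (\<Sum>i\<in>S. f i powr r)"
proof (cases "S = {}")
  case False
  define c where "c = real (card S)"
  have c: "c > 0" using False assms by (simp add: c_def card_gt_0_iff)
  have "(\<Sum>i\<in>S. (1 / c) *\<^sub>R f i) powr r \<le> (\<Sum>i\<in>S. (1 / c) * f i powr r)"
    using c by (intro convex_on_sum[OF _ False convex_on_powr_nonneg])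
      (auto simp: assms c_def[symmetric])
  then have "(\<Sum>i\<in>S. f i) powr r / c powr r \<le> (\<Sum>i\<in>S. f i powr r) / c"
    by (simp add: sum_divide_distrib[symmetric] powr_divide)
  then show ?thesis
    unfolding c_def[symmetric] using c by (simp add: powr_diff field_simps)
qed simp

lemma powr_powr_inverse [simp]:
  fixes x r :: real
  assumes "0 < r" "0 \<le> x"
  shows "(x powr (1 / r)) powr r = x" "(x powr r) powr (1 / r) = x"
  using assms by (simp_all add: powr_powr)

section \<open>Quasi-norms on index sets: comparison and Minkowski\<close>

definition lr_on :: "real \<Rightarrow> 'a set \<Rightarrow> ('a \<Rightarrow> real) \<Rightarrow> real" where
  "lr_on r S f = (\<Sum>i\<in>S. \<bar>f i\<bar> powr r) powr (1 / r)"

lemma lr_on_nonneg [simp]: "0 \<le> lr_on r S f"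
  by (simp add: lr_on_def)

lemma lr_on_powr: "0 < r \<Longrightarrow> lr_on r S f powr r = (\<Sum>i\<in>S. \<bar>f i\<bar> powr r)"
  by (simp add: lr_on_def sum_nonneg)

lemma lr_norm_eq_lr_on: "lr_norm r u = lr_on r UNIV (\<lambda>i. u $ i)"
  by (simp add: lr_norm_def lr_on_def)

lemma lr_on_2: "lr_on 2 S f = L2_set f S"
  by (simp add: lr_on_def L2_set_def powr_half_sqrt sum_nonneg)

lemma lr_on_1: "lr_on 1 S f = (\<Sum>i\<in>S. \<bar>f i\<bar>)"
  by (simp add: lr_on_def sum_nonneg)

text \<open>The power \<open>r / s \<le> 1\<close> is subadditive; it is applied to the s-th powers
  of the entries.\<close>

lemma lr_on_antimono:
  assumes "finite S" "0 < r" "r \<le> s"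
  shows "lr_on s S f \<le> lr_on r S f"
proof -
  have "(\<Sum>i\<in>S. \<bar>f i\<bar> powr s) powr (r / s) \<le> (\<Sum>i\<in>S. (\<bar>f i\<bar> powr s) powr (r / s))"
    using assms by (intro powr_sum_le) auto
  then have "((\<Sum>i\<in>S. \<bar>f i\<bar> powr s) powr (r / s)) powr (1 / r) \<le> (\<Sum>i\<in>S. \<bar>f i\<bar> powr r) powr (1 / r)"
    using assms by (intro powr_mono2) (auto simp: powr_powr)
  then show ?thesis using assms by (simp add: lr_on_def powr_powr)
qed

text \<open>Jensen with exponent \<open>s / r\<close> on the r-th powers of the entries.\<close>

lemma lr_on_le_card:
  assumes "finite S" "0 < r" "r \<le> s"
  shows "lr_on r S f \<le> real (card S) powr (1 / r - 1 / s) * lr_on s S f"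
proof -
  have "(\<Sum>i\<in>S. \<bar>f i\<bar> powr r) powr (s / r)
      \<le> real (card S) powr (s / r - 1) * (\<Sum>i\<in>S. (\<bar>f i\<bar> powr r) powr (s / r))"
    using assms by (intro powr_sum_le_card) auto
  then have "((\<Sum>i\<in>S. \<bar>f i\<bar> powr r) powr (s / r)) powr (1 / s)
      \<le> (real (card S) powr (s / r - 1) * (\<Sum>i\<in>S. \<bar>f i\<bar> powr s)) powr (1 / s)"
    using assms by (intro powr_mono2) (auto simp: powr_powr)
  moreover have "(s / r - 1) * (1 / s) = 1 / r - 1 / s" using assms by (simp add: field_simps)
  ultimately show ?thesis using assms by (simp add: lr_on_def powr_powr powr_mult)
qed

text \<open>This is the source of \<open>\<theta>\<close>: passing from l_2 to l_q costs a power of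
  the cardinality for \<open>q \<le> 2\<close> and nothing for larger \<open>q\<close>.\<close>

lemma lr_on_le_L2_set:
  assumes "finite S" "card S \<le> n" "0 < q"
  shows "lr_on q S f \<le> real n powr (max (1 / q - 1 / 2) 0) * L2_set f S"
proof (cases "S = {}")
  case False
  \<comment> \<open>In HOL \<open>0 powr 0 = 0\<close>, so the exponent 0 yields the factor 1 only
    for positive \<open>n\<close>.\<close>
  then have n: "1 \<le> card S" using assms by (simp add: Suc_le_eq card_gt_0_iff)
  show ?thesis
  proof (cases "q \<le> 2")
    case True
    then have *: "max (1 / q - 1 / 2) 0 = 1 / q - 1 / 2" "0 \<le> 1 / q - 1 / 2"
      using assms by (auto simp: field_simps)
    have "lr_on q S f \<le> real (card S) powr (1 / q - 1 / 2) * L2_set f S"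
      using lr_on_le_card[of S q 2 f] True assms by (simp add: lr_on_2)
    also have "\<dots> \<le> real n powr (1 / q - 1 / 2) * L2_set f S"
      using assms * by (intro mult_right_mono powr_mono2) auto
    finally show ?thesis using * by simp
  next
    case False
    then have "max (1 / q - 1 / 2) 0 = 0" using assms by (simp add: field_simps)
    then show ?thesis using lr_on_antimono[of S 2 q f] False assms n by (simp add: lr_on_2)
  qed
qed (simp add: lr_on_def)

text \<open>On disjoint sets the q-th powers add up exactly, and the power
  \<open>1 / q \<le> 1\<close> is subadditive.\<close>

lemma lr_on_Un_le:
  assumes "finite S" "finite T" "S \<inter> T = {}" "1 \<le> q"
  shows "lr_on q (S \<union> T) f \<le> lr_on q S f + lr_on q T f"
  unfolding lr_on_def using assms
  by (simp add: sum.union_disjoint powr_add_le sum_nonneg)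

lemma lr_on_Union_le:
  assumes "finite P" "\<And>B. B \<in> P \<Longrightarrow> finite B" "disjoint P" "1 \<le> q"
  shows "lr_on q (\<Union>P) f \<le> (\<Sum>B\<in>P. lr_on q B f)"
  using assms(1-3)
proof (induction P rule: finite_induct)
  case empty
  then show ?case by (simp add: lr_on_def)
next
  case (insert B P)
  have "lr_on q (B \<union> \<Union>P) f \<le> lr_on q B f + lr_on q (\<Union>P) f"
    using insert assms(4) by (intro lr_on_Un_le) (auto simp: disjoint_def)
  then show ?case using insert by (force simp: disjoint_def)
qed

text \<open>Minkowski's inequality: up to the factor \<open>F + G\<close>, the sum is a convex
  combination of the normalised functions \<open>f / F\<close> and \<open>g / G\<close>, and
  convexity of the q-th power applies entrywise.\<close>

lemma lr_on_triangle:
  assumes "1 \<le> q" "finite S"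
  shows "lr_on q S (\<lambda>i. f i + g i) \<le> lr_on q S f + lr_on q S g"
proof -
  define F G where "F = lr_on q S f" and "G = lr_on q S g"
  have F: "(\<Sum>i\<in>S. \<bar>f i\<bar> powr q) = F powr q" and G: "(\<Sum>i\<in>S. \<bar>g i\<bar> powr q) = G powr q"
    using assms by (simp_all add: F_def G_def lr_on_powr)
  have FG: "0 \<le> F" "0 \<le> G" by (simp_all add: F_def G_def)
  consider "F = 0" | "G = 0" | "0 < F" "0 < G" using FG by fastforce
  then show ?thesis
  proof cases
    case 1
    then have "\<forall>i\<in>S. f i = 0" using F assms by (simp add: sum_nonneg_eq_0_iff)
    then have "lr_on q S (\<lambda>i. f i + g i) = lr_on q S g" by (simp add: lr_on_def)
    then show ?thesis by simp
  next
    case 2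
    then have "\<forall>i\<in>S. g i = 0" using G assms by (simp add: sum_nonneg_eq_0_iff)
    then have "lr_on q S (\<lambda>i. f i + g i) = lr_on q S f" by (simp add: lr_on_def)
    then show ?thesis by simp
  next
    case 3
    define s where "s = G / (F + G)"
    have s: "0 \<le> s" "s \<le> 1" "1 - s = F / (F + G)" using 3 by (auto simp: s_def field_simps)
    have "\<bar>f i + g i\<bar> powr q \<le> (F + G) powr q * ((1 - s) * (\<bar>f i\<bar> powr q / F powr q) + s * (\<bar>g i\<bar> powr q / G powr q))" for i
    proof -
      have "\<bar>f i + g i\<bar> \<le> (F + G) * ((1 - s) * (\<bar>f i\<bar> / F) + s * (\<bar>g i\<bar> / G))"
      proof -
        have "(F + G) * ((1 - s) * (\<bar>f i\<bar> / F) + s * (\<bar>g i\<bar> / G)) = \<bar>f i\<bar> + \<bar>g i\<bar>"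
        proof -
          have "(F + G) * (1 - s) = F" "(F + G) * s = G" using 3 by (simp_all add: s(3), simp add: s_def)
          then show ?thesis using 3 by (simp add: distrib_left flip: mult.assoc)
        qed
        then show ?thesis using abs_triangle_ineq by simp
      qed
      then have "\<bar>f i + g i\<bar> powr q \<le> (F + G) powr q * ((1 - s) * (\<bar>f i\<bar> / F) + s * (\<bar>g i\<bar> / G)) powr q"
        using assms by (subst powr_mult[symmetric]) (intro powr_mono2, auto)
      also have "((1 - s) * (\<bar>f i\<bar> / F) + s * (\<bar>g i\<bar> / G)) powr q
          \<le> (1 - s) * (\<bar>f i\<bar> / F) powr q + s * (\<bar>g i\<bar> / G) powr q"
        using convex_onD[OF convex_on_powr_nonneg[OF assms(1)], of s "\<bar>f i\<bar> / F" "\<bar>g i\<bar> / G"] s 3 by simp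
      finally show ?thesis by (simp add: powr_divide mult_left_mono)
    qed
    then have "(\<Sum>i\<in>S. \<bar>f i + g i\<bar> powr q) \<le> (\<Sum>i\<in>S. (F + G) powr q *
        ((1 - s) * (\<bar>f i\<bar> powr q / F powr q) + s * (\<bar>g i\<bar> powr q / G powr q)))"
      by (intro sum_mono)
    also have "\<dots> = (F + G) powr q"
      using 3 by (simp only: sum_distrib_left[symmetric] sum.distrib sum_divide_distrib[symmetric] F G) simp
    finally have "lr_on q S (\<lambda>i. f i + g i) \<le> ((F + G) powr q) powr (1 / q)"
      unfolding lr_on_def using assms by (intro powr_mono2 sum_nonneg) auto
    then show ?thesis using 3 assms F_def G_def by simp
  qed
qed

section \<open>Decreasing blocks and tail sums\<close>

lemma exists_top_subset:
  fixes g :: "'a \<Rightarrow> real"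
  assumes "finite U" "t \<le> card U"
  shows "\<exists>B\<subseteq>U. card B = t \<and> (\<forall>i\<in>B. \<forall>j\<in>U - B. g j \<le> g i)"
  using assms(2)
proof (induction t)
  case 0
  show ?case by (rule exI[of _ "{}"]) simp
next
  case (Suc t)
  then obtain B where B: "B \<subseteq> U" "card B = t" "\<forall>i\<in>B. \<forall>j\<in>U - B. g j \<le> g i" by auto
  have fin: "finite B" using B assms finite_subset by blast
  have ne: "U - B \<noteq> {}" using B Suc.prems fin card_mono[of B U] by auto
  have "Max (g ` (U - B)) \<in> g ` (U - B)" using ne assms by (intro Max_in) auto
  then obtain m where m: "m \<in> U - B" "g m = Max (g ` (U - B))" by auto
  have max: "g j \<le> g m" if "j \<in> U - B" for j
    unfolding m(2) using that assms by (intro Max_ge) auto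
  show ?case
    by (rule exI[of _ "insert m B"]) (use B m(1) max fin in auto)
qed

text \<open>
  For \<open>card B < t\<close> the block is thought of as padded with zeros, which forces \<open>m = 0\<close>.
\<close>

lemma L2_set_le_sum_plus_range:
  fixes g :: "'a \<Rightarrow> real"
  assumes fin: "finite B" and t: "0 < t" and mM: "0 \<le> m" "m \<le> M"
    and g: "\<And>i. i \<in> B \<Longrightarrow> m \<le> g i \<and> g i \<le> M"
    and card: "card B = t \<or> m = 0"
  shows "L2_set g B \<le> (\<Sum>i\<in>B. g i) / sqrt t + sqrt t / 4 * (M - m)"
proof -
  define s where "s = (\<Sum>i\<in>B. g i)"
  have s0: "0 \<le> s" unfolding s_def using g mM by (intro sum_nonneg) force
  \<comment> \<open>On [m, M] the square lies below its chord, which is linear, so the bound depends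
    on \<open>g\<close> only through its sum \<open>s\<close>.\<close>
  have "(\<Sum>i\<in>B. (g i)\<^sup>2) \<le> (\<Sum>i\<in>B. (m + M) * g i - m * M)"
  proof (intro sum_mono)
    fix i assume "i \<in> B"
    then have "0 \<le> (g i - m) * (M - g i)" using g by simp
    then show "(g i)\<^sup>2 \<le> (m + M) * g i - m * M" by (simp add: algebra_simps power2_eq_square)
  qed
  also have "\<dots> = (m + M) * s - real (card B) * m * M"
    by (simp add: sum_subtractf sum_distrib_left[symmetric] s_def)
  also have "\<dots> = (m + M) * s - t * m * M" using card by auto
  \<comment> \<open>The constant 1/4 is tight: for \<open>m = 0\<close> the two sides differ by
    exactly the square \<open>(s - t * M / 4)\<^sup>2 / t\<close>.\<close>
  also have "\<dots> \<le> (s / sqrt t + sqrt t / 4 * (M - m))\<^sup>2"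
  proof -
    have "(s / sqrt t + sqrt t / 4 * (M - m))\<^sup>2 = s\<^sup>2 / t + s * (M - m) / 2 + t * (M - m)\<^sup>2 / 16"
      using t by (simp add: power2_sum power_divide power_mult_distrib)
    \<comment> \<open>complete the square in \<open>s\<close>\<close>
    moreover have "s\<^sup>2 / t + s * (M - m) / 2 + t * (M - m)\<^sup>2 / 16 - ((m + M) * s - t * m * M)
        = (s - t * (M + 3 * m) / 4)\<^sup>2 / t + t * m * (M - m) / 2"
      using t by (simp add: field_simps power2_eq_square)
    moreover have "0 \<le> (s - t * (M + 3 * m) / 4)\<^sup>2 / t + t * m * (M - m) / 2"
      using t mM by simp
    ultimately show ?thesis by linarith
  qed
  finally have "L2_set g B \<le> sqrt ((s / sqrt t + sqrt t / 4 * (M - m))\<^sup>2)"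
    unfolding L2_set_def by (rule real_sqrt_le_mono)
  also have "\<dots> = s / sqrt t + sqrt t / 4 * (M - m)" using s0 mM by simp
  finally show ?thesis by (simp add: s_def)
qed

text \<open>The \<open>t\<close> largest entries are split off repeatedly. The minimum of a block
  serves as upper bound \<open>M\<close> for the rest, so the range terms \<open>M - m\<close>
  telescope and only the initial \<open>M\<close> survives.\<close>

lemma block_partition:
  fixes g :: "'a \<Rightarrow> real"
  assumes "finite U" and t: "0 < t" and "0 \<le> M" and "\<And>i. i \<in> U \<Longrightarrow> 0 \<le> g i \<and> g i \<le> M"
  shows "\<exists>P. finite P \<and> disjoint P \<and> \<Union>P = U \<and> (\<forall>B\<in>P. card B \<le> t) \<and>
     (\<Sum>B\<in>P. L2_set g B) \<le> (\<Sum>i\<in>U. g i) / sqrt t + sqrt t / 4 * M"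
  using assms(1,3,4)
proof (induction "card U" arbitrary: U M rule: less_induct)
  case less
  show ?case
  proof (cases "card U \<le> t")
    case True
    \<comment> \<open>The last block may be shorter than \<open>t\<close>, hence the lower bound 0
      for its entries.\<close>
    have "L2_set g U \<le> (\<Sum>i\<in>U. g i) / sqrt t + sqrt t / 4 * (M - 0)"
      using less.prems t by (intro L2_set_le_sum_plus_range) auto
    then show ?thesis
      using True by (intro exI[of _ "{U}"]) (simp add: disjoint_def)
  next
    case False
    then obtain B where B: "B \<subseteq> U" "card B = t" "\<forall>i\<in>B. \<forall>j\<in>U - B. g j \<le> g i"
      using exists_top_subset[of U t g] less.prems by auto
    have finB: "finite B" using B less.prems finite_subset by blast
    have neB: "B \<noteq> {}" using B t by auto
    obtain m where m: "m \<in> B" "\<forall>j\<in>B. g m \<le> g j"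
      using ex_is_arg_min_if_finite[OF finB neB, of g]
      by (force simp: is_arg_min_linorder)
    have "card (U - B) < card U"
      using less.prems neB B by (intro psubset_card_mono) auto
    moreover have "0 \<le> g m" "g m \<le> M" using m B less.prems by auto
    ultimately obtain P where P: "finite P" "disjoint P" "\<Union>P = U - B" "\<forall>B\<in>P. card B \<le> t"
      "(\<Sum>B\<in>P. L2_set g B) \<le> (\<Sum>i\<in>U - B. g i) / sqrt t + sqrt t / 4 * g m"
      using less.hyps[of "U - B" "g m"] less.prems m B by auto
    have notin: "B \<notin> P" using P neB by auto
    have "L2_set g B \<le> (\<Sum>i\<in>B. g i) / sqrt t + sqrt t / 4 * (M - g m)"
      using less.prems t m B finB by (intro L2_set_le_sum_plus_range) auto
    then have "(\<Sum>B\<in>insert B P. L2_set g B)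
        \<le> ((\<Sum>i\<in>B. g i) + (\<Sum>i\<in>U - B. g i)) / sqrt t + sqrt t / 4 * M"
      using P notin by (simp add: add_divide_distrib diff_divide_distrib algebra_simps)
    also have "(\<Sum>i\<in>B. g i) + (\<Sum>i\<in>U - B. g i) = (\<Sum>i\<in>U. g i)"
      using sum.subset_diff[OF B(1) less.prems(1), of g] by simp
    finally show ?thesis
      using P B by (intro exI[of _ "insert B P"]) (auto simp: disjoint_def)
  qed
qed

text \<open>
  Each \<open>\<bar>f i\<bar>\<close> with \<open>i \<in> U\<close> splits as \<open>\<bar>f i\<bar> powr p * \<bar>f i\<bar> powr (1 - p)\<close>, and the second factor is
  controlled by the average over \<open>T\<close>; this is what produces the negative power of \<open>k\<close>.
\<close>

lemma sum_complement_le: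
  fixes f :: "'a \<Rightarrow> real"
  assumes fin: "finite T" "finite U" and k: "0 < card T" and p: "0 < p" "p \<le> 1"
    and top: "\<And>i j. i \<in> T \<Longrightarrow> j \<in> U \<Longrightarrow> \<bar>f j\<bar> \<le> \<bar>f i\<bar>"
  shows "(\<Sum>i\<in>U. \<bar>f i\<bar>) \<le> real (card T) powr ((p - 1) / p) * max (lr_on p T f) (lr_on p U f)"
proof -
  define k Y X where "k = real (card T)" and "Y = lr_on p T f" and "X = lr_on p U f"
  have k0: "0 < k" using k by (simp add: k_def)
  have "\<bar>f j\<bar> \<le> Y / k powr (1 / p)" if "j \<in> U" for j
  proof -
    have "k * \<bar>f j\<bar> powr p \<le> (\<Sum>i\<in>T. \<bar>f i\<bar> powr p)"
      unfolding k_def using that top p by (intro sum_bounded_below powr_mono2) auto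
    then have "(k * \<bar>f j\<bar> powr p) powr (1 / p) \<le> Y"
      unfolding Y_def lr_on_def using p k0 by (intro powr_mono2) auto
    then show ?thesis using p k0 by (simp add: powr_mult field_simps)
  qed
  then have "(\<Sum>i\<in>U. \<bar>f i\<bar>) \<le> (\<Sum>i\<in>U. \<bar>f i\<bar> powr p * (Y / k powr (1 / p)) powr (1 - p))"
  proof (intro sum_mono)
    fix i assume "i \<in> U" and *: "\<And>j. j \<in> U \<Longrightarrow> \<bar>f j\<bar> \<le> Y / k powr (1 / p)"
    have "\<bar>f i\<bar> = \<bar>f i\<bar> powr p * \<bar>f i\<bar> powr (1 - p)"
      by (simp add: powr_add[symmetric])
    also have "\<dots> \<le> \<bar>f i\<bar> powr p * (Y / k powr (1 / p)) powr (1 - p)"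
      using *[OF \<open>i \<in> U\<close>] p by (intro mult_left_mono powr_mono2) auto
    finally show "\<bar>f i\<bar> \<le> \<dots>" .
  qed
  also have "\<dots> = X powr p * (Y / k powr (1 / p)) powr (1 - p)"
    using p by (simp add: sum_distrib_right X_def lr_on_powr)
  also have "\<dots> = k powr ((p - 1) / p) * (X powr p * Y powr (1 - p))"
  proof -
    have "(p - 1) / p = - ((1 - p) / p)" by (simp add: minus_divide_left)
    then show ?thesis by (simp add: powr_divide powr_powr powr_minus_divide)
  qed
  \<comment> \<open>With both quasi-norms replaced by their maximum, the exponents \<open>p\<close>
    and \<open>1 - p\<close> add up to 1.\<close>
  also have "\<dots> \<le> k powr ((p - 1) / p) * (max Y X powr p * max Y X powr (1 - p))"
    using p by (intro mult_left_mono mult_mono powr_mono2) (auto simp: X_def Y_def)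
  also have "max Y X powr p * max Y X powr (1 - p) = max Y X"
    by (simp add: powr_add[symmetric] X_def Y_def le_max_iff_disj)
  finally show ?thesis by (simp add: k_def X_def Y_def)
qed

section \<open>Restriction of vectors and restricted isometry\<close>

definition restr :: "'n set \<Rightarrow> real ^ 'n \<Rightarrow> real ^ 'n" where
  "restr B u = (\<chi> i. if i \<in> B then u $ i else 0)"

lemma restr_nth [simp]: "restr B u $ i = (if i \<in> B then u $ i else 0)"
  by (simp add: restr_def)

lemma norm_restr: "norm (restr B u) = L2_set (\<lambda>i. u $ i) B"
proof -
  have "(\<Sum>i\<in>UNIV. (restr B u $ i)\<^sup>2) = (\<Sum>i\<in>B. (u $ i)\<^sup>2)"
    by (rule sum.mono_neutral_cong_right) auto
  then show ?thesis by (simp add: norm_vec_def L2_set_def)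
qed

lemma card_support_restr: "card {i. restr B u $ i \<noteq> 0} \<le> card B"
  by (rule card_mono) auto

lemma restr_Union_disjoint:
  assumes "finite P" "disjoint P"
  shows "restr (\<Union>P) u = (\<Sum>B\<in>P. restr B u)"
  using assms
proof (induction P rule: finite_induct)
  case (insert B P)
  have *: "\<Union>P \<inter> B = {}"
    using insert.prems insert.hyps(2) by (auto simp: pairwise_insert disjnt_def)
  have "disjoint P" using insert.prems by (simp add: pairwise_insert)
  have "restr (B \<union> \<Union>P) u $ i = restr B u $ i + restr (\<Union>P) u $ i" for i
    using * by (cases "i \<in> B") auto
  then have "restr (B \<union> \<Union>P) u = restr B u + restr (\<Union>P) u"
    by (simp add: vec_eq_iff)
  then show ?case using insert.IH[OF \<open>disjoint P\<close>] insert.hyps by simp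
qed (simp add: vec_eq_iff)

text \<open>Tested on a unit coordinate vector. It ensures \<open>0 \<le> sqrt (1 + d)\<close>, as
  HOL's \<open>sqrt\<close> is negative on negative arguments.\<close>

lemma rip_bound_nonneg:
  fixes A :: "real ^ 'n ^ 'm"
  assumes "rip_bound A s d" "1 \<le> s"
  shows "0 \<le> 1 + d"
proof -
  let ?u = "axis undefined 1 :: real ^ 'n"
  have "{i. ?u $ i \<noteq> 0} = {undefined}" by (auto simp: axis_def)
  then have "(norm (A *v ?u))\<^sup>2 \<le> 1 + d"
    using assms(1)[unfolded rip_bound_def, rule_format, of ?u] assms(2) by (simp add: norm_axis_1)
  then show ?thesis using order_trans zero_le_power2 by blast
qed

lemma rip_bound_norm_le:
  assumes "rip_bound A s d" "card {i. u $ i \<noteq> 0} \<le> s"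
  shows "norm (A *v u) \<le> sqrt (1 + d) * norm u"
proof -
  have "sqrt ((norm (A *v u))\<^sup>2) \<le> sqrt ((1 + d) * (norm u)\<^sup>2)"
    using assms by (intro real_sqrt_le_mono) (simp add: rip_bound_def)
  then show ?thesis by (simp add: real_sqrt_mult)
qed

lemma norm_add_scaleR_squared:
  fixes y z :: "'a :: real_inner"
  shows "(norm (y + c *\<^sub>R z))\<^sup>2 = (norm y)\<^sup>2 + 2 * c * (y \<bullet> z) + c\<^sup>2 * (norm z)\<^sup>2"
  by (simp only: power2_norm_eq_inner inner_add_left inner_add_right inner_scaleR_left
      inner_scaleR_right inner_commute[of z y]) (simp add: algebra_simps power2_eq_square)

text \<open>Polarisation: for normalised orthogonal vectors, the sum and the difference both have
  squared norm 2 and support of size at most \<open>s\<close>, so the isometry bounds control the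
  difference of their squared images, four times the inner product.\<close>

lemma rip_bound_inner_le:
  fixes A :: "real ^ 'n ^ 'm" and u v :: "real ^ 'n"
  assumes rip: "rip_bound A s d"
    and card: "card {i. u $ i \<noteq> 0} + card {i. v $ i \<noteq> 0} \<le> s"
    and disj: "\<And>i. u $ i = 0 \<or> v $ i = 0"
  shows "\<bar>(A *v u) \<bullet> (A *v v)\<bar> \<le> d * norm u * norm v"
proof (cases "u = 0 \<or> v = 0")
  case False
  define u' v' where "u' = u /\<^sub>R norm u" and "v' = v /\<^sub>R norm v"
  have nz: "norm u > 0" "norm v > 0" using False by auto
  have norms: "norm u' = 1" "norm v' = 1" using nz by (simp_all add: u'_def v'_def)
  have "u \<bullet> v = 0"
    unfolding inner_vec_def using disj by (intro sum.neutral) auto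
  then have orth: "u' \<bullet> v' = 0" by (simp add: u'_def v'_def)
  have supp: "card {i. (u' + c *\<^sub>R v') $ i \<noteq> 0} \<le> s" for c
  proof -
    have "card {i. (u' + c *\<^sub>R v') $ i \<noteq> 0} \<le> card ({i. u $ i \<noteq> 0} \<union> {i. v $ i \<noteq> 0})"
      by (rule card_mono) (auto simp: u'_def v'_def)
    also have "\<dots> \<le> s" using card card_Un_le order_trans by blast
    finally show ?thesis .
  qed
  have expA: "(norm (A *v (u' + c *\<^sub>R v')))\<^sup>2
      = (norm (A *v u'))\<^sup>2 + 2 * c * ((A *v u') \<bullet> (A *v v')) + c\<^sup>2 * (norm (A *v v'))\<^sup>2" for c
    by (simp only: matrix_vector_right_distrib matrix_vector_mult_scaleR norm_add_scaleR_squared)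
  have expI: "(norm (u' + c *\<^sub>R v'))\<^sup>2 = 1 + c\<^sup>2" for c
    by (simp only: norm_add_scaleR_squared norms orth) simp
  have *: "(1 - d) * (1 + c\<^sup>2) \<le> (norm (A *v (u' + c *\<^sub>R v')))\<^sup>2"
    "(norm (A *v (u' + c *\<^sub>R v')))\<^sup>2 \<le> (1 + d) * (1 + c\<^sup>2)" for c
    using rip supp[of c] unfolding rip_bound_def expI[symmetric] by blast+
  have "\<bar>(A *v u') \<bullet> (A *v v')\<bar> \<le> d"
    using *[of 1] *[of "-1"] unfolding expA by (simp add: algebra_simps abs_le_iff)
  moreover have "(A *v u) \<bullet> (A *v v) = norm u * norm v * ((A *v u') \<bullet> (A *v v'))"
    using nz by (simp add: u'_def v'_def matrix_vector_mult_scaleR field_simps)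
  ultimately show ?thesis using nz
    by (simp add: abs_mult mult.commute mult.left_commute mult_left_mono)
qed auto

section \<open>The cone condition\<close>

text \<open>The common part cancels. The remainders \<open>S - T\<close> and \<open>T - S\<close>
  have equal size, and every value on the latter dominates every value on the former.\<close>

lemma sum_top_ge:
  fixes g :: "'a \<Rightarrow> real"
  assumes fin: "finite S" "finite T" and card: "card S = card T"
    and top: "\<And>i j. i \<in> T \<Longrightarrow> j \<notin> T \<Longrightarrow> g j \<le> g i"
  shows "sum g S \<le> sum g T"
proof -
  have "card (S \<inter> T) + card (S - T) = card (S \<inter> T) + card (T - S)"
    using fin card by (metis card_Int_Diff inf_commute)
  then have eq: "card (S - T) = card (T - S)" by simp
  have "sum g (S - T) \<le> sum g (T - S)"
  proof (cases "S - T = {}")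
    case True
    then have "card (T - S) = 0" using eq by (metis card.empty)
    then have "T - S = {}" using fin by simp
    then show ?thesis using True by simp
  next
    case False
    define M where "M = Max (g ` (S - T))"
    have "M \<in> g ` (S - T)" using False fin unfolding M_def by (intro Max_in) auto
    then have "sum g (T - S) \<ge> of_nat (card (T - S)) * M"
      using top by (intro sum_bounded_below) auto
    moreover have "sum g (S - T) \<le> of_nat (card (S - T)) * M"
      unfolding M_def using fin by (intro sum_bounded_above) auto
    ultimately show ?thesis using eq by simp
  qed
  moreover have "sum g S = sum g (S \<inter> T) + sum g (S - T)"
    using fin by (subst sum.Int_Diff[of S _ T]) auto
  moreover have "sum g T = sum g (S \<inter> T) + sum g (T - S)"
    using fin by (subst sum.Int_Diff[of T _ S]) (auto simp: Int_commute)
  ultimately show ?thesis by simp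
qed

lemma lr_norm_pos:
  assumes "u \<noteq> 0" "0 < r"
  shows "0 < lr_norm r u"
proof -
  have "(\<Sum>i\<in>UNIV. \<bar>u $ i\<bar> powr r) \<noteq> 0"
    using assms by (auto simp: sum_nonneg_eq_0_iff vec_eq_iff)
  then show ?thesis by (simp add: lr_norm_def)
qed

text \<open>With \<open>c\<close> the ratio of \<open>x\<close>, the p-quasi-norm of
  \<open>z\<close> is at most \<open>c * lr_norm q z\<close>, and Minkowski bounds this by
  \<open>lr_norm p x + c * lr_norm q h\<close>. In p-th powers, \<open>x\<close> on \<open>S\<close>
  is compared with \<open>z\<close> and \<open>h\<close>, and \<open>h\<close> off \<open>S\<close>
  with \<open>z\<close> and \<open>x\<close>; the \<open>z\<close> terms cancel and the tail of
  \<open>x\<close> is counted twice.\<close>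

lemma ratio_cone:
  fixes x z :: "real ^ 'n"
  assumes p: "0 < p" "p \<le> 1" and q: "1 \<le> q" and nz: "x \<noteq> 0" "z \<noteq> 0"
    and le: "lr_norm p z / lr_norm q z \<le> lr_norm p x / lr_norm q x"
    and \<beta>: "lr_norm p x / lr_norm q x \<le> \<beta>"
  shows "(\<Sum>i\<in>-S. \<bar>(z - x) $ i\<bar> powr p) \<le> (\<Sum>i\<in>S. \<bar>(z - x) $ i\<bar> powr p)
     + 2 * (\<Sum>i\<in>-S. \<bar>x $ i\<bar> powr p) + (\<beta> * lr_norm q (z - x)) powr p"
proof -
  define c where "c = lr_norm p x / lr_norm q x"
  define h where "h = z - x"
  have pos: "0 < lr_norm q x" "0 < lr_norm q z" "0 < lr_norm p x"
    using lr_norm_pos[OF nz(1)] lr_norm_pos[OF nz(2)] p q by auto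
  have c: "0 < c" "c \<le> \<beta>" "lr_norm p x = c * lr_norm q x" using pos \<beta> by (auto simp: c_def)
  have hn: "0 \<le> lr_norm q h" by (simp add: lr_norm_def)
  have split: "(\<Sum>i\<in>UNIV. f i) = (\<Sum>i\<in>S. f i) + (\<Sum>i\<in>-S. f i)" for f :: "'n \<Rightarrow> real"
    by (metis Compl_eq_Diff_UNIV finite_UNIV subset_UNIV sum.subset_diff add.commute finite)
  have "lr_norm q z = lr_norm q (x + h)" by (simp add: h_def)
  also have "\<dots> \<le> lr_norm q x + lr_norm q h"
    using lr_on_triangle[of q UNIV "\<lambda>i. x $ i" "\<lambda>i. h $ i"] q by (simp add: lr_norm_eq_lr_on)
  finally have "c * lr_norm q z \<le> lr_norm p x + c * lr_norm q h"
    using c by (simp flip: distrib_left)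
  then have "lr_norm p z \<le> lr_norm p x + c * lr_norm q h"
    using le pos by (simp add: c_def[symmetric] pos_divide_le_eq)
  also have "\<dots> \<le> lr_norm p x + \<beta> * lr_norm q h"
    using c hn by (simp add: mult_right_mono)
  finally have "lr_norm p z powr p \<le> (lr_norm p x + \<beta> * lr_norm q h) powr p"
    using p by (intro powr_mono2) (auto simp: lr_norm_def)
  also have "\<dots> \<le> lr_norm p x powr p + (\<beta> * lr_norm q h) powr p"
    using p c hn pos by (intro powr_add_le) auto
  finally have main: "(\<Sum>i\<in>S. \<bar>z $ i\<bar> powr p) + (\<Sum>i\<in>-S. \<bar>z $ i\<bar> powr p)
      \<le> (\<Sum>i\<in>S. \<bar>x $ i\<bar> powr p) + (\<Sum>i\<in>-S. \<bar>x $ i\<bar> powr p) + (\<beta> * lr_norm q h) powr p"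
    using p by (simp add: lr_norm_eq_lr_on lr_on_powr split)
  have *: "\<bar>u + v\<bar> powr p \<le> \<bar>u\<bar> powr p + \<bar>v\<bar> powr p" for u v :: real
    using powr_mono2[of p "\<bar>u + v\<bar>" "\<bar>u\<bar> + \<bar>v\<bar>"] powr_add_le[of p "\<bar>u\<bar>" "\<bar>v\<bar>"] p by fastforce
  have "(\<Sum>i\<in>S. \<bar>x $ i\<bar> powr p) \<le> (\<Sum>i\<in>S. \<bar>z $ i\<bar> powr p + \<bar>h $ i\<bar> powr p)"
    using *[of "z $ i" "- h $ i" for i] by (intro sum_mono) (simp add: h_def abs_minus_commute)
  moreover have "(\<Sum>i\<in>-S. \<bar>h $ i\<bar> powr p) \<le> (\<Sum>i\<in>-S. \<bar>z $ i\<bar> powr p + \<bar>x $ i\<bar> powr p)"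
    using *[of "z $ i" "- x $ i" for i] by (intro sum_mono) (simp add: h_def)
  ultimately show ?thesis using main by (simp add: sum.distrib h_def)
qed

text \<open>The constant \<open>a\<close> is the price of comparing l_p with l_1 on three
  entries.\<close>

lemma powr_add3_le:
  fixes u v w p :: real
  assumes "0 < p" "p \<le> 1" "0 \<le> u" "0 \<le> v" "0 \<le> w"
  shows "(u powr p + v powr p + w powr p) powr (1 / p) \<le> 3 powr ((1 - p) / p) * (u + v + w)"
proof -
  define f where "f = (\<lambda>i::nat. if i = 0 then u else if i = 1 then v else w)"
  have "lr_on p {0,1,2} f \<le> real (card {0,1,2::nat}) powr (1 / p - 1 / 1) * lr_on 1 {0,1,2} f"
    using assms by (intro lr_on_le_card) auto
  moreover have "1 / p - 1 / 1 = (1 - p) / p" using assms by (simp add: field_simps)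
  ultimately show ?thesis
    using assms by (simp add: lr_on_1 add.assoc, simp add: lr_on_def f_def add.assoc)
qed

theorem theorem6p7:
  fixes A :: "real ^ 'n ^ 'm" and b :: "real ^ 'm" and x xhat xmax :: "real ^ 'n"
    and p q \<beta> \<epsilon> :: real and k t :: nat
    and a \<theta> \<rho> \<alpha> \<eta> C \<tau> \<psi> C1 C2 :: real
  assumes "0 < p" "p \<le> 1" "q > 1" "\<beta> > 0" "\<epsilon> \<ge> 0"
    and "x \<noteq> 0"
    and "norm (b - A *v x) \<le> \<epsilon>"
    and "lr_norm p x / lr_norm q x \<le> \<beta>"
    and "is_arg_min (\<lambda>z. lr_norm p z powr p / lr_norm q z powr p)
           (\<lambda>z. z \<noteq> 0 \<and> norm (A *v z - b) \<le> \<epsilon>) xhat"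
    and "1 \<le> k" "k < CARD('n)" "1 \<le> t" "t \<le> CARD('n) - k"
    and "a = 3 powr ((1 - p) / p)"
    and "\<theta> = max (1 / q - 1 / 2) 0"
    and "\<rho> = a * sqrt (real k / real t) + 1 / 4 * sqrt (real t / real k)"
    and "\<alpha> = a * \<beta> * real k powr ((p - 1) / p + \<theta>) * real t powr (- 1 / 2)"
    and "\<eta> = a * \<beta> * real k powr ((p - 1) / p) * real t powr (\<theta> - 1 / 2)"
    and "C = a * 2 powr (1 / p) * real k powr ((p - 1) / p) * real t powr (- 1 / 2)"
    and "\<tau> = (\<rho> + \<alpha>) / (1 - \<eta>)"
    and "\<psi> = ric A k + ric A (k + t) * \<tau>"
    and "rip A (k + t)"
    and "\<eta> < 1"
    and "\<psi> < 1"
    and "C1 = C / (1 - \<eta>) * (1 + (1 + \<tau>) * ric A (k + t) / (1 - \<psi>))"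
    and "C2 = 2 * (1 + \<tau>) * sqrt (1 + ric A k) / (1 - \<psi>)"
    and "is_max_part k x xmax"
  shows "norm (xhat - x) \<le> C1 * lr_norm p (x - xmax) + C2 * \<epsilon>"
proof -
  note p = \<open>0 < p\<close> \<open>p \<le> 1\<close>
  define h where "h = xhat - x"
  define \<sigma> where "\<sigma> = lr_norm p (x - xmax)"
  define Q where "Q = lr_norm q h"
  have \<sigma>0: "0 \<le> \<sigma>" and Q0: "0 \<le> Q" by (simp_all add: \<sigma>_def Q_def lr_norm_def)
  have k0: "0 < k" and t0: "0 < t" using \<open>1 \<le> k\<close> \<open>1 \<le> t\<close> by auto
  have a1: "1 \<le> a" using p by (simp add: assms(14) ge_one_powr_ge_zero)
  have \<rho>0: "0 \<le> \<rho>" and \<alpha>0: "0 \<le> \<alpha>" and C0: "0 \<le> C"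
    using a1 \<open>\<beta> > 0\<close> by (simp_all add: assms(16,17,19))
  have \<tau>0: "0 \<le> \<tau>" using \<rho>0 \<alpha>0 \<open>\<eta> < 1\<close> by (simp add: assms(20))

  \<comment> \<open>Cone condition for the error vector\<close>
  obtain S where S: "card S = k" "xmax = (\<chi> i. if i \<in> S then x $ i else 0)"
    using \<open>is_max_part k x xmax\<close> by (auto simp: is_max_part_def)
  have "(\<Sum>i\<in>UNIV. \<bar>(x - xmax) $ i\<bar> powr p) = (\<Sum>i\<in>-S. \<bar>x $ i\<bar> powr p)"
    by (rule sum.mono_neutral_cong_right) (auto simp: S)
  then have \<sigma>_powr: "\<sigma> powr p = (\<Sum>i\<in>-S. \<bar>x $ i\<bar> powr p)"
    using p by (simp add: \<sigma>_def lr_norm_eq_lr_on lr_on_powr)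
  obtain T where T: "card T = k" "\<And>i j. i \<in> T \<Longrightarrow> j \<notin> T \<Longrightarrow> \<bar>h $ j\<bar> \<le> \<bar>h $ i\<bar>"
    using exists_top_subset[of "UNIV :: 'n set" k "\<lambda>i. \<bar>h $ i\<bar>"] \<open>k < CARD('n)\<close> by auto
  define H Y X where "H = L2_set (\<lambda>i. h $ i) T" and "Y = lr_on p T (\<lambda>i. h $ i)"
    and "X = lr_on p (-T) (\<lambda>i. h $ i)"
  have H0: "0 \<le> H" by (simp add: H_def)

  have xhat: "xhat \<noteq> 0" "norm (A *v xhat - b) \<le> \<epsilon>"
    "lr_norm p xhat powr p / lr_norm q xhat powr p \<le> lr_norm p x powr p / lr_norm q x powr p"
    using assms(6,7,9) by (auto simp: is_arg_min_linorder norm_minus_commute)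
  have ratio_le: "lr_norm p xhat / lr_norm q xhat \<le> lr_norm p x / lr_norm q x"
  proof (rule ccontr)
    assume "\<not> ?thesis"
    then have "(lr_norm p x / lr_norm q x) powr p < (lr_norm p xhat / lr_norm q xhat) powr p"
      using p by (intro powr_less_mono2) (auto simp: lr_norm_def)
    then show False using xhat(3) by (simp add: powr_divide)
  qed
  have "(\<Sum>i\<in>-S. \<bar>h $ i\<bar> powr p) \<le> (\<Sum>i\<in>S. \<bar>h $ i\<bar> powr p) + 2 * \<sigma> powr p + (\<beta> * Q) powr p"
    unfolding h_def \<sigma>_powr Q_def using p \<open>q > 1\<close> \<open>x \<noteq> 0\<close> xhat(1) assms(8) ratio_le by (intro ratio_cone) auto
  \<comment> \<open>The cone inequality holds for the support \<open>S\<close> of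
    \<open>xmax\<close>. Passing to \<open>T\<close> enlarges the sum on the set and, the total
    being fixed, shrinks the one on the complement.\<close>
  moreover have "(\<Sum>i\<in>S. \<bar>h $ i\<bar> powr p) \<le> (\<Sum>i\<in>T. \<bar>h $ i\<bar> powr p)"
    using S T p by (intro sum_top_ge powr_mono2) auto
  moreover have "(\<Sum>i\<in>S. \<bar>h $ i\<bar> powr p) + (\<Sum>i\<in>-S. \<bar>h $ i\<bar> powr p)
      = (\<Sum>i\<in>T. \<bar>h $ i\<bar> powr p) + (\<Sum>i\<in>-T. \<bar>h $ i\<bar> powr p)"
    by (simp flip: sum.union_disjoint add: Compl_disjoint)
  \<comment> \<open>The factor 2 is moved inside the p-th power, whence
    \<open>2 powr (1 / p)\<close> in \<open>C\<close>.\<close>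
  ultimately have "X powr p \<le> Y powr p + (2 powr (1 / p) * \<sigma>) powr p + (\<beta> * Q) powr p"
    using p by (simp add: X_def Y_def lr_on_powr powr_mult[of _ \<sigma>])
  then have "(X powr p) powr (1 / p)
      \<le> (Y powr p + (2 powr (1 / p) * \<sigma>) powr p + (\<beta> * Q) powr p) powr (1 / p)"
    using p by (intro powr_mono2) auto
  also have "\<dots> \<le> a * (Y + 2 powr (1 / p) * \<sigma> + \<beta> * Q)"
    unfolding assms(14) using p \<sigma>0 Q0 \<open>\<beta> > 0\<close> by (intro powr_add3_le) (auto simp: Y_def)
  finally have X_le: "X \<le> a * (Y + 2 powr (1 / p) * \<sigma> + \<beta> * Q)"
    using p by (simp add: X_def)
  \<comment> \<open>Since \<open>1 \<le> a\<close>, the bound on \<open>X\<close> also covers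
    \<open>Y\<close>, as the maximum in \<open>sum_complement_le\<close> demands.\<close>
  have "1 * Y \<le> a * (Y + 2 powr (1 / p) * \<sigma> + \<beta> * Q)"
    using a1 \<sigma>0 Q0 \<open>\<beta> > 0\<close> by (intro mult_mono) (auto simp: Y_def)
  with X_le have max_le: "max Y X \<le> a * (Y + 2 powr (1 / p) * \<sigma> + \<beta> * Q)" by simp

  \<comment> \<open>Bounding the sum of block norms\<close>
  define N where "N = (\<Sum>i\<in>-T. \<bar>h $ i\<bar>)"
  have N_le: "N \<le> a * sqrt k * H + a * 2 powr (1 / p) * k powr ((p - 1) / p) * \<sigma>
      + a * \<beta> * k powr ((p - 1) / p) * Q"
  proof -
    have "N \<le> k powr ((p - 1) / p) * max Y X"
      unfolding N_def Y_def X_def T(1)[symmetric] using T k0 p by (intro sum_complement_le) auto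
    also have "\<dots> \<le> k powr ((p - 1) / p) * (a * (Y + 2 powr (1 / p) * \<sigma> + \<beta> * Q))"
      using max_le by (intro mult_left_mono) auto
    also have "\<dots> = a * (k powr ((p - 1) / p) * Y) + a * 2 powr (1 / p) * k powr ((p - 1) / p) * \<sigma>
      + a * \<beta> * k powr ((p - 1) / p) * Q"
      by (simp add: algebra_simps)
    \<comment> \<open>Comparing l_p with l_2 on \<open>T\<close> brings the exponent of
      \<open>k\<close> to 1/2, which leads to the first term of \<open>\<rho>\<close>.\<close>
    also have "k powr ((p - 1) / p) * Y \<le> k powr ((p - 1) / p) * (k powr (1 / p - 1 / 2) * H)"
      using lr_on_le_card[of T p 2 "\<lambda>i. h $ i"] p T by (simp add: Y_def H_def lr_on_2 mult_left_mono)
    also have "\<dots> = k powr ((p - 1) / p + (1 / p - 1 / 2)) * H"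
      by (simp only: powr_add mult.assoc)
    also have "(p - 1) / p + (1 / p - 1 / 2) = 1 / 2" using p by (simp add: field_simps)
    finally show ?thesis using a1 by (simp add: powr_half_sqrt mult_left_mono mult.assoc)
  qed

  \<comment> \<open>\<open>M\<close> is the root mean square of \<open>h\<close> on
    \<open>T\<close>; an entry off \<open>T\<close> is below each of the \<open>k\<close> entries
    there. It produces the second term of \<open>\<rho>\<close>.\<close>
  define M where "M = H / sqrt k"
  have M: "\<bar>h $ j\<bar> \<le> M" if "j \<in> -T" for j
  proof -
    have "real (card T) * (h $ j)\<^sup>2 \<le> (\<Sum>i\<in>T. (h $ i)\<^sup>2)"
      using that T by (intro sum_bounded_below) (simp add: abs_le_square_iff)
    then have "sqrt (k * (h $ j)\<^sup>2) \<le> H"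
      unfolding H_def L2_set_def using T by (intro real_sqrt_le_mono) simp
    then show ?thesis using k0 by (simp add: M_def real_sqrt_mult field_simps)
  qed
  have M0: "0 \<le> M" using H0 by (simp add: M_def)
  obtain P where P: "finite P" "disjoint P" "\<Union>P = -T" "\<forall>B\<in>P. card B \<le> t"
    and P_le: "(\<Sum>B\<in>P. L2_set (\<lambda>i. \<bar>h $ i\<bar>) B) \<le> N / sqrt t + sqrt t / 4 * M"
    using block_partition[of "-T" t M "\<lambda>i. \<bar>h $ i\<bar>"] t0 M0 M by (auto simp: N_def)
  define \<Sigma> where "\<Sigma> = (\<Sum>B\<in>P. L2_set (\<lambda>i. h $ i) B)"
  have \<Sigma>0: "0 \<le> \<Sigma>" by (simp add: \<Sigma>_def sum_nonneg)
  have \<Sigma>1: "\<Sigma> \<le> N / sqrt t + sqrt t / 4 * M"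
    using P_le by (simp add: \<Sigma>_def L2_set_def)

  \<comment> \<open>\<open>T\<close> pays the factor \<open>k powr \<theta>\<close>, which enters
    \<open>\<alpha>\<close>; each block pays \<open>t powr \<theta>\<close>, which enters
    \<open>\<eta>\<close>.\<close>
  have Q_le: "Q \<le> k powr \<theta> * H + t powr \<theta> * \<Sigma>"
  proof -
    have "Q \<le> lr_on q T (\<lambda>i. h $ i) + lr_on q (-T) (\<lambda>i. h $ i)"
      using lr_on_Un_le[of T "-T" q] \<open>q > 1\<close> by (simp add: Q_def lr_norm_eq_lr_on)
    also have "lr_on q T (\<lambda>i. h $ i) \<le> k powr \<theta> * H"
      unfolding assms(15) H_def using T \<open>q > 1\<close> by (intro lr_on_le_L2_set) auto
    also have "lr_on q (-T) (\<lambda>i. h $ i) \<le> (\<Sum>B\<in>P. lr_on q B (\<lambda>i. h $ i))"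
      using P \<open>q > 1\<close> lr_on_Union_le[of P q] by simp
    also have "\<dots> \<le> (\<Sum>B\<in>P. t powr \<theta> * L2_set (\<lambda>i. h $ i) B)"
      unfolding assms(15) using P \<open>q > 1\<close> by (intro sum_mono lr_on_le_L2_set) auto
    finally show ?thesis by (simp add: \<Sigma>_def sum_distrib_left)
  qed

  have t_half: "t powr (- 1 / 2) = 1 / sqrt t"
    using t0 by (simp add: powr_minus_divide powr_half_sqrt)
  have "\<Sigma> \<le> (a * sqrt k * H + a * 2 powr (1 / p) * k powr ((p - 1) / p) * \<sigma>
      + a * \<beta> * k powr ((p - 1) / p) * (k powr \<theta> * H + t powr \<theta> * \<Sigma>)) / sqrt t + sqrt t / 4 * M"
  proof -
    have "a * \<beta> * k powr ((p - 1) / p) * Q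
        \<le> a * \<beta> * k powr ((p - 1) / p) * (k powr \<theta> * H + t powr \<theta> * \<Sigma>)"
      using Q_le a1 \<open>\<beta> > 0\<close> by (intro mult_left_mono) auto
    with N_le have "N \<le> a * sqrt k * H + a * 2 powr (1 / p) * k powr ((p - 1) / p) * \<sigma>
      + a * \<beta> * k powr ((p - 1) / p) * (k powr \<theta> * H + t powr \<theta> * \<Sigma>)" by linarith
    then show ?thesis using \<Sigma>1 t0 by (meson add_right_mono divide_right_mono order_trans real_sqrt_ge_zero of_nat_0_le_iff)
  qed
  also have "\<dots> = (\<rho> + \<alpha>) * H + C * \<sigma> + \<eta> * \<Sigma>"
  proof -
    have "t powr (\<theta> - 1 / 2) = t powr \<theta> / sqrt t"
      using t0 by (simp add: powr_diff powr_half_sqrt)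
    then show ?thesis
      unfolding assms(16-19) M_def t_half
      by (simp add: powr_add real_sqrt_divide algebra_simps add_divide_distrib)
  qed
  finally have "\<Sigma> * (1 - \<eta>) \<le> (\<rho> + \<alpha>) * H + C * \<sigma>" by (simp add: algebra_simps)
  then have "\<Sigma> \<le> ((\<rho> + \<alpha>) * H + C * \<sigma>) / (1 - \<eta>)"
    using \<open>\<eta> < 1\<close> by (simp add: pos_le_divide_eq)
  then have \<Sigma>_le: "\<Sigma> \<le> \<tau> * H + C / (1 - \<eta>) * \<sigma>"
    by (simp add: assms(20) add_divide_distrib[of _ "C * \<sigma>"])

  \<comment> \<open>Restricted isometry and the final estimate\<close>
  define D where "D = C / (1 - \<eta>) * \<sigma>"
  define \<delta> where "\<delta> = ric A (k + t)"
  have \<delta>0: "0 \<le> \<delta>" using \<open>rip A (k + t)\<close> by (simp add: rip_def \<delta>_def)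
  have ripk: "rip_bound A k (ric A k)" using ric_least(1)[of k A] \<open>1 \<le> k\<close> .
  have ripkt: "rip_bound A (k + t) \<delta>" using ric_least(1)[of "k + t" A] \<open>1 \<le> k\<close> by (simp add: \<delta>_def)
  define s where "s = sqrt (1 + ric A k)"
  have s0: "0 \<le> s" using rip_bound_nonneg[OF ripk \<open>1 \<le> k\<close>] by (simp add: s_def)
  have "h = restr T h + restr (-T) h" by (simp add: vec_eq_iff)
  then have h_eq: "h = restr T h + (\<Sum>B\<in>P. restr B h)"
    using restr_Union_disjoint[OF P(1,2), of h] by (simp only: P(3))
  have normT: "norm (restr T h) = H" by (simp add: norm_restr H_def)
  have normB: "norm (restr B h) = L2_set (\<lambda>i. h $ i) B" for B by (simp add: norm_restr)
  have cardT: "card {i. restr T h $ i \<noteq> 0} \<le> k" using card_support_restr[of T h] T by simp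

  have Ah: "norm (A *v h) \<le> 2 * \<epsilon>"
  proof -
    have "A *v h = (A *v xhat - b) + (b - A *v x)" by (simp add: h_def matrix_vector_mult_diff_distrib)
    then show ?thesis using norm_triangle_ineq[of "A *v xhat - b" "b - A *v x"] xhat(2) assms(7) by simp
  qed
  have "(1 - ric A k) * H\<^sup>2 \<le> (norm (A *v restr T h))\<^sup>2"
    using ripk cardT unfolding rip_bound_def normT[symmetric] by blast
  also have "\<dots> = (A *v restr T h) \<bullet> (A *v h) - (\<Sum>B\<in>P. (A *v restr T h) \<bullet> (A *v restr B h))"
  proof -
    have "A *v h = A *v restr T h + (\<Sum>B\<in>P. A *v restr B h)"
      by (subst h_eq) (simp add: matrix_vector_right_distrib
          linear_sum[OF matrix_vector_mul_linear])
    then show ?thesis by (simp add: inner_add_right inner_sum_right power2_norm_eq_inner)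
  qed
  also have "\<dots> \<le> (s * H) * (2 * \<epsilon>) + (\<Sum>B\<in>P. \<delta> * H * L2_set (\<lambda>i. h $ i) B)"
  proof -
    have "(A *v restr T h) \<bullet> (A *v h) \<le> norm (A *v restr T h) * norm (A *v h)"
      by (rule norm_cauchy_schwarz)
    also have "\<dots> \<le> (s * H) * (2 * \<epsilon>)"
      using rip_bound_norm_le[OF ripk cardT] Ah s0 H0
      by (intro mult_mono) (auto simp: s_def normT)
    finally have 1: "(A *v restr T h) \<bullet> (A *v h) \<le> (s * H) * (2 * \<epsilon>)" .
    have "- (\<Sum>B\<in>P. (A *v restr T h) \<bullet> (A *v restr B h)) \<le> (\<Sum>B\<in>P. \<delta> * H * L2_set (\<lambda>i. h $ i) B)"
      unfolding sum_negf[symmetric]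
    proof (intro sum_mono)
      fix B assume "B \<in> P"
      \<comment> \<open>A block and \<open>T\<close> are disjoint with at most \<open>k + t\<close>
        indices together, so the isometry constant of order \<open>k + t\<close> applies to the
        pair.\<close>
      then have "card B \<le> t" "B \<inter> T = {}" using P by auto
      then have "\<bar>(A *v restr T h) \<bullet> (A *v restr B h)\<bar> \<le> \<delta> * norm (restr T h) * norm (restr B h)"
        using cardT card_support_restr[of B h]
        by (intro rip_bound_inner_le[OF ripkt]) auto
      then show "- ((A *v restr T h) \<bullet> (A *v restr B h)) \<le> \<delta> * H * L2_set (\<lambda>i. h $ i) B"
        unfolding normT unfolding normB by linarith
    qed
    with 1 show ?thesis by simp
  qed
  also have "\<dots> = (2 * s * \<epsilon> + \<delta> * \<Sigma>) * H"
    by (simp add: \<Sigma>_def algebra_simps sum_distrib_left)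
  also have "\<dots> \<le> (2 * s * \<epsilon> + \<delta> * (\<tau> * H + D)) * H"
    using \<Sigma>_le \<delta>0 H0 by (intro mult_right_mono add_left_mono mult_left_mono) (auto simp: D_def)
  \<comment> \<open>Moving \<open>\<delta> * \<tau> * H\<^sup>2\<close> to the left turns
    \<open>1 - ric A k\<close> into \<open>1 - \<psi>\<close>.\<close>
  finally have "((1 - \<psi>) * H) * H \<le> (2 * s * \<epsilon> + \<delta> * D) * H"
    by (simp add: assms(21) \<delta>_def algebra_simps power2_eq_square)
  \<comment> \<open>For \<open>H = 0\<close> no factor can be cancelled; the bound then follows from
    nonnegativity of its right-hand side.\<close>
  moreover have D0: "0 \<le> D" using C0 \<sigma>0 \<open>\<eta> < 1\<close> by (simp add: D_def)
  ultimately have "(1 - \<psi>) * H \<le> 2 * s * \<epsilon> + \<delta> * D"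
    using H0 s0 \<delta>0 \<open>\<epsilon> \<ge> 0\<close> by (cases "H = 0") auto
  then have H_le: "H \<le> (2 * s * \<epsilon> + \<delta> * D) / (1 - \<psi>)"
    using \<open>\<psi> < 1\<close> by (simp add: pos_le_divide_eq mult.commute)

  have "norm h \<le> norm (restr T h) + norm (\<Sum>B\<in>P. restr B h)"
    by (subst h_eq) (rule norm_triangle_ineq)
  also have "\<dots> \<le> H + \<Sigma>"
    unfolding normT \<Sigma>_def normB[symmetric] by (intro add_left_mono norm_sum)
  also have "\<dots> \<le> (1 + \<tau>) * H + D" using \<Sigma>_le by (simp add: D_def algebra_simps)
  also have "\<dots> \<le> (1 + \<tau>) * ((2 * s * \<epsilon> + \<delta> * D) / (1 - \<psi>)) + D"
    using H_le \<tau>0 by (intro add_right_mono mult_left_mono) auto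
  \<comment> \<open>\<open>D\<close> enters both directly and through the bound on \<open>H\<close>,
    giving the two summands in the bracket of \<open>C1\<close>.\<close>
  also have "\<dots> = C1 * \<sigma> + C2 * \<epsilon>"
    by (simp add: assms(25,26) D_def \<delta>_def s_def algebra_simps add_divide_distrib)
  finally show ?thesis by (simp add: h_def \<sigma>_def)
qed

end
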